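(* If $H=(V,E)$ is a $k$-uniform, $k$-regular hypergraph, where $k\in\mathbb{Z}$, $k\ge 3$, then $V$ can be partitioned into hyperedges of $H^h$ of size $2$ and at most one hyperedge of $H^h$ of size $3$.
   Context: A hypergraph $H=(V,E)$ consists of a vertex set $V$ and a family $E$ of subsets of $V$ called hyperedges, where hyperedges may be present with multiplicities. $H$ is $k$-uniform if all of its hyperedges have $k$ elements, and $k$-regular if every vertex is contained in exactly $k$ hyperedges (counted with multiplicity). The hereditary closure of $H$ is the hypergraph $H^h=(V,E^h)$ with $E^h=\{X : X\subseteq e \text{ for some } e\in E\}$.
   Formalization: The hypergraph is taken finite and, in addition, connected: without connectedness the claim fails, e.g. for two disjoint 3-sets each taken as a hyperedge three times (k=3), where two parts of size 3 are needed. For disconnected H the result applies to each component. *)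

theory Defs
  imports Main "HOL-Library.Multiset" "HOL-Library.Disjoint_Sets"
begin

text \<open>
  Hypergraphs are finite; hyperedges come with multiplicities, so the family \<open>E\<close> is a
  multiset of vertex sets.
\<close>

definition hypergraph :: "'a set \<Rightarrow> 'a set multiset \<Rightarrow> bool" where
  "hypergraph V E \<longleftrightarrow> finite V \<and> (\<forall>e\<in>#E. e \<subseteq> V)"

definition uniform :: "nat \<Rightarrow> 'a set multiset \<Rightarrow> bool" where
  "uniform k E \<longleftrightarrow> (\<forall>e\<in>#E. card e = k)"

definition regular :: "nat \<Rightarrow> 'a set \<Rightarrow> 'a set multiset \<Rightarrow> bool" where
  "regular k V E \<longleftrightarrow> (\<forall>v\<in>V. size {#e \<in># E. v \<in> e#} = k)"

text \<open>
  Connectedness is not part of the informal statement but is added here: without it the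
  theorem is false, since the disjoint union of two 3-sets, each taken as a hyperedge three times, is
  3-uniform and 3-regular, but hyperedges of the hereditary closure stay inside one of the two
  3-sets, so each of them needs its own part of size 3.
\<close>

definition hconnected :: "'a set \<Rightarrow> 'a set multiset \<Rightarrow> bool" where
  "hconnected V E \<longleftrightarrow> (\<forall>u\<in>V. \<forall>v\<in>V. (u, v) \<in> {(x, y). \<exists>e\<in>#E. x \<in> e \<and> y \<in> e}\<^sup>*)"

text \<open>
  The hyperedge set \<open>E\<^sup>h\<close> of the hereditary closure \<open>(V, E\<^sup>h)\<close>; it is a plain set,
  without multiplicities.
\<close>

definition hereditary_closure :: "'a set multiset \<Rightarrow> 'a set set" where
  "hereditary_closure E = {X. \<exists>e\<in>#E. X \<subseteq> e}"

end

theory Submission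
  imports Defs
begin

text \<open>
  Join two vertices when they share a hyperedge. If \<open>S \<noteq> {}\<close> is deleted, the hyperedges meeting a
  component \<open>C\<close> of the rest lie in \<open>C \<union> S\<close>; if there are \<open>m\<close> of them, they have
  \<open>k m - k |C|\<close> incidences with \<open>S\<close>, a positive multiple of \<open>k\<close>. As \<open>S\<close> has only \<open>k |S|\<close>
  incidences and no hyperedge meets two components, there are at most \<open>|S|\<close> components. By the
  Tutte--Berge formula the graph has a perfect matching if \<open>|V|\<close> is even and is factor-critical
  if \<open>|V|\<close> is odd. In the odd case choose a factor-critical proper subset \<open>W\<close> such that \<open>V - W\<close> is
  the interior of an ear, the ear being as short as possible. The first edge of that interior
  lies, since \<open>k \<ge> 3\<close>, in a triangle contained in a hyperedge, and deleting this triangle leaves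
  a graph with a perfect matching.
\<close>

section \<open>Perfectly matchable sets\<close>

text \<open>A matching is recorded only through the vertex set it covers. Two-element members of
  \<open>F\<close> alone serve as edges, so \<open>F\<close> may be a whole hereditary
  closure.\<close>

inductive matchable :: "'a set set \<Rightarrow> 'a set \<Rightarrow> bool" for F where
  empty: "matchable F {}"
| add_edge: "\<lbrakk>matchable F A; {x, y} \<in> F; x \<noteq> y; x \<notin> A; y \<notin> A\<rbrakk>
    \<Longrightarrow> matchable F (insert x (insert y A))"

lemma matchable_finite: "matchable F A \<Longrightarrow> finite A"
  by (induction rule: matchable.induct) auto

lemma matchable_even: "matchable F A \<Longrightarrow> even (card A)"
proof (induction rule: matchable.induct)
  case (add_edge A x y)
  then show ?case using matchable_finite[of F A] by simp
qed simp

lemma matchable_Un: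
  assumes "matchable F A" "matchable F B" "A \<inter> B = {}"
  shows "matchable F (A \<union> B)"
  using assms
proof (induction rule: matchable.induct)
  case (add_edge A x y)
  then show ?case using matchable.add_edge[of F "A \<union> B" x y] by simp
qed simp

text \<open>Rule inversion exposes only the edge added last. The edges of a matching are disjoint
  and can be added in any order, so the edge at a prescribed vertex may come last.\<close>

lemma matchable_partner:
  assumes "matchable F A" "x \<in> A"
  obtains y where "y \<in> A" "y \<noteq> x" "{x, y} \<in> F" "matchable F (A - {x, y})"
proof -
  have "\<exists>y. y \<in> A \<and> y \<noteq> x \<and> {x, y} \<in> F \<and> matchable F (A - {x, y})"
    using assms
  proof (induction rule: matchable.induct)
    case (add_edge A a b)
    consider "x = a" | "x = b" | "x \<in> A" "x \<noteq> a" "x \<noteq> b" using add_edge by auto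
    then show ?case
    proof cases
      case 1
      with add_edge have "insert a (insert b A) - {x, b} = A" by auto
      with 1 add_edge show ?thesis by (intro exI[of _ b]) auto
    next
      case 2
      with add_edge have "insert a (insert b A) - {x, a} = A" by auto
      with 2 add_edge show ?thesis by (intro exI[of _ a]) (auto simp: insert_commute)
    next
      case 3
      with add_edge obtain y where y: "y \<in> A" "y \<noteq> x" "{x, y} \<in> F" "matchable F (A - {x, y})"
        by auto
      have "insert a (insert b A) - {x, y} = insert a (insert b (A - {x, y}))"
        using 3 y add_edge by auto
      moreover have "matchable F (insert a (insert b (A - {x, y})))"
        using y add_edge by (intro matchable.add_edge) auto
      ultimately have "matchable F (insert a (insert b A) - {x, y})" by simp
      then show ?thesis using y(1-3) by blast
    qed
  qed simp
  then show thesis using that by blast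
qed

section \<open>From matchable sets to partitions into pairs\<close>

lemma partition_on_add_part:
  assumes "partition_on A P" "X \<inter> A = {}" "X \<noteq> {}"
  shows "partition_on (X \<union> A) (insert X P)"
proof -
  have "disjoint (insert X P)"
    using assms unfolding partition_on_def pairwise_insert disjnt_def by blast
  then show ?thesis using assms by (simp add: partition_on_def)
qed

lemma matchable_partition:
  assumes "matchable F A"
  obtains P where "partition_on A P" "P \<subseteq> F" "\<forall>X\<in>P. card X = 2"
proof -
  have "\<exists>P. partition_on A P \<and> P \<subseteq> F \<and> (\<forall>X\<in>P. card X = 2)"
    using assms
  proof (induction rule: matchable.induct)
    case empty
    then show ?case by (intro exI[of _ "{}"]) (simp add: partition_on_empty)
  next
    case (add_edge A x y)
    then obtain P where P: "partition_on A P" "P \<subseteq> F" "\<forall>X\<in>P. card X = 2" by auto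
    have "partition_on (insert x (insert y A)) (insert {x, y} P)"
      using partition_on_add_part[OF P(1), of "{x, y}"] add_edge by simp
    then show ?case using P add_edge by (intro exI[of _ "insert {x, y} P"]) auto
  qed
  then show thesis using that by blast
qed

text \<open>The exchange property of the matching matroid: follow the alternating path that starts
  at \<open>v\<close>.\<close>

lemma matchable_exchange:
  assumes "matchable F A" "matchable F B" "v \<in> A" "v \<notin> B"
  shows "(\<exists>u\<in>B - A. matchable F (insert u (A - {v})))
    \<or> (\<exists>u\<in>A - B. u \<noteq> v \<and> matchable F (insert v (insert u B)))"
  using assms
proof (induction "card A" arbitrary: A B v rule: less_induct)
  case less
  obtain y where y: "y \<in> A" "y \<noteq> v" "{v, y} \<in> F" "matchable F (A - {v, y})"
    by (rule matchable_partner[OF less.prems(1,3)])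
  show ?case
  proof (cases "y \<in> B")
    case False
    then have "matchable F (insert v (insert y B))"
      using less.prems y by (intro matchable.add_edge) auto
    then show ?thesis using y False by blast
  next
    case True
    then obtain z where z: "z \<in> B" "z \<noteq> y" "{y, z} \<in> F" "matchable F (B - {y, z})"
      using matchable_partner[OF less.prems(2)] by blast
    have zv: "z \<noteq> v" using z less.prems by auto
    show ?thesis
    proof (cases "z \<in> A")
      case False
      have "matchable F (insert y (insert z (A - {v, y})))"
        using y z False by (intro matchable.add_edge) auto
      moreover have "insert y (insert z (A - {v, y})) = insert z (A - {v})"
        using y by auto
      ultimately show ?thesis using z False by auto
    next
      case zA: True
      \<comment> \<open>The path goes on: without the edges \<open>{v, y}\<close> and
        \<open>{y, z}\<close> both sets are again matchable, and \<open>z\<close> now lies only in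
        the first, as \<open>v\<close> did.\<close>
      have "card (A - {v, y}) < card A"
        using less.prems matchable_finite[OF less.prems(1)] by (intro psubset_card_mono) auto
      from less.hyps[OF this y(4) z(4), of z] zA zv z
      consider u where "u \<in> B - {y, z}" "u \<notin> A - {v, y}" "matchable F (insert u (A - {v, y} - {z}))"
        | u where "u \<in> A - {v, y}" "u \<notin> B - {y, z}" "u \<noteq> z" "matchable F (insert z (insert u (B - {y, z})))"
        by auto
      then show ?thesis
      proof cases
        case 1
        \<comment> \<open>Trading \<open>z\<close> for \<open>u\<close> frees \<open>z\<close>,
          which is then matched to \<open>y\<close>; the net effect on \<open>A\<close> is to trade
          \<open>v\<close> for \<open>u\<close>.\<close>
        have "matchable F (insert y (insert z (insert u (A - {v, y} - {z}))))"
          using 1 z by (intro matchable.add_edge) auto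
        moreover have "insert y (insert z (insert u (A - {v, y} - {z}))) = insert u (A - {v})"
          using y zA zv by auto
        ultimately show ?thesis using 1 less.prems by auto
      next
        case 2
        have "matchable F (insert v (insert y (insert z (insert u (B - {y, z})))))"
          using 2 y z zv less.prems
          by (intro matchable.add_edge[of F "insert z (insert u (B - {y, z}))"]) auto
        moreover have "insert v (insert y (insert z (insert u (B - {y, z})))) = insert v (insert u B)"
          using z True by auto
        ultimately show ?thesis using 2 by auto
      qed
    qed
  qed
qed

section \<open>The Tutte--Berge bound\<close>

text \<open>The members of \<open>\<C>\<close> are nonempty unions of components of the graph on
  \<open>V - S\<close>; they may be disconnected or of even order, and need not cover
  \<open>V - S\<close>.\<close>

definition separated :: "'a set set \<Rightarrow> 'a set \<Rightarrow> 'a set \<Rightarrow> 'a set set \<Rightarrow> bool" where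
  "separated F V S \<C> \<longleftrightarrow> disjoint \<C>
    \<and> (\<forall>C\<in>\<C>. C \<noteq> {} \<and> C \<subseteq> V - S \<and> (\<forall>x\<in>C. \<forall>y\<in>V. {x, y} \<in> F \<longrightarrow> y \<in> C \<union> S))"

text \<open>Gallai's lemma: if every vertex is missed by some maximum matching, then the vertices
  that no maximum matching misses together form classes closed under adjacency.\<close>

lemma gallai_classes:
  assumes "finite V"
    and max: "\<And>B. B \<subseteq> V \<Longrightarrow> matchable F B \<Longrightarrow> card B \<le> m"
    and miss: "\<And>v. v \<in> V \<Longrightarrow> \<exists>B\<subseteq>V. matchable F B \<and> card B = m \<and> v \<notin> B"
    and A: "A \<subseteq> V" "matchable F A" "card A = m"
  shows "\<exists>\<C>. separated F V {} \<C> \<and> card (V - A) \<le> card \<C>"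
proof -
  \<comment> \<open>Two vertices are related when no maximum matching misses both. Equality is added
    separately, since each single vertex is missed by some maximum matching.\<close>
  define r where "r = {(u, v). u \<in> V \<and> v \<in> V \<and> (u = v \<or>
    \<not> (\<exists>B\<subseteq>V. matchable F B \<and> card B = m \<and> u \<notin> B \<and> v \<notin> B))}"
  have adj: "(x, y) \<in> r" if xy: "x \<in> V" "y \<in> V" "{x, y} \<in> F" for x y
  proof (rule ccontr)
    assume "(x, y) \<notin> r"
    then obtain B where B: "B \<subseteq> V" "matchable F B" "card B = m" "x \<notin> B" "y \<notin> B" "x \<noteq> y"
      using xy by (auto simp: r_def)
    have "matchable F (insert x (insert y B))"
      using B xy by (intro matchable.add_edge) auto
    then have "card (insert x (insert y B)) \<le> m" using max B xy by simp
    then show False using B finite_subset[OF B(1) assms(1)] by simp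
  qed
  have tr: "trans r"
  proof (rule transI)
    fix u v w assume uv: "(u, v) \<in> r" and vw: "(v, w) \<in> r"
    show "(u, w) \<in> r"
    proof (rule ccontr)
      assume "(u, w) \<notin> r"
      then obtain B where B: "B \<subseteq> V" "matchable F B" "card B = m" "u \<notin> B" "w \<notin> B" "u \<noteq> w"
        using uv vw by (auto simp: r_def)
      have "v \<in> V" using uv by (auto simp: r_def)
      have "v \<in> B" using B uv vw by (auto simp: r_def)
      obtain D where D: "D \<subseteq> V" "matchable F D" "card D = m" "v \<notin> D"
        using miss[OF \<open>v \<in> V\<close>] by auto
      have finB: "finite B" and finD: "finite D"
        using B D assms(1) finite_subset by auto
      \<comment> \<open>The second outcome of the exchange would enlarge the maximum matching on
        \<open>D\<close>.\<close>
      have "\<not> matchable F (insert v (insert x D))" if "x \<in> B - D" "x \<noteq> v" for x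
      proof
        assume "matchable F (insert v (insert x D))"
        moreover have "insert v (insert x D) \<subseteq> V" using that D B \<open>v \<in> V\<close> by auto
        ultimately have "card (insert v (insert x D)) \<le> m" using max by simp
        then show False using D finD that by simp
      qed
      then obtain x where x: "x \<in> D - B" "matchable F (insert x (B - {v}))"
        using matchable_exchange[OF B(2) D(2) \<open>v \<in> B\<close> D(4)] by auto
      \<comment> \<open>This maximum matching misses \<open>v\<close> and, apart from
        \<open>x\<close>, all that \<open>B\<close> misses. As \<open>x\<close> equals at most one
        of \<open>u\<close> and \<open>w\<close>, it misses \<open>v\<close> together with the
        other.\<close>
      let ?B = "insert x (B - {v})"
      have sub: "?B \<subseteq> V" using B D x by auto
      have c: "card ?B = m" using x finB B(3) card_Suc_Diff1[OF finB \<open>v \<in> B\<close>] by simp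
      have v: "v \<notin> ?B" using x D by auto
      consider "x \<noteq> u" | "x \<noteq> w" using B(6) by auto
      then show False
      proof cases
        case 1
        then have "u \<notin> ?B" using B by auto
        then have "u = v" using uv sub c v x by (auto simp: r_def)
        then show ?thesis using \<open>v \<in> B\<close> B by auto
      next
        case 2
        then have "w \<notin> ?B" using B by auto
        then have "w = v" using vw sub c v x by (auto simp: r_def)
        then show ?thesis using \<open>v \<in> B\<close> B by auto
      qed
    qed
  qed
  have eq: "equiv V r"
    using tr by (auto intro!: equivI refl_onI symI simp: r_def)
  have "separated F V {} (V // r)"
    unfolding separated_def
  proof (intro conjI ballI impI)
    show "disjoint (V // r)" using quotient_disj[OF eq] by (auto simp: disjoint_def)
  next
    fix C assume C: "C \<in> V // r"
    show "C \<noteq> {}" using C eq in_quotient_imp_non_empty by metis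
    show "C \<subseteq> V - {}" using C eq in_quotient_imp_subset by fastforce
    fix x y assume "x \<in> C" "y \<in> V" "{x, y} \<in> F"
    then have "(x, y) \<in> r" using adj \<open>C \<subseteq> V - {}\<close> by auto
    then show "y \<in> C \<union> {}" using in_quotient_imp_closed[OF eq C \<open>x \<in> C\<close>] by auto
  qed
  \<comment> \<open>Distinct vertices outside \<open>A\<close> lie in different classes, because the
    maximum matching on \<open>A\<close> misses both.\<close>
  moreover have "card (V - A) \<le> card (V // r)"
  proof (rule card_inj_on_le[where f = "\<lambda>v. r `` {v}"])
    show "inj_on (\<lambda>v. r `` {v}) (V - A)"
    proof (rule inj_onI)
      fix x y assume *: "x \<in> V - A" "y \<in> V - A" "r `` {x} = r `` {y}"
      then have "(x, y) \<in> r" using eq_equiv_class_iff[OF eq] by auto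
      then show "x = y" using * A by (auto simp: r_def)
    qed
    show "(\<lambda>v. r `` {v}) ` (V - A) \<subseteq> V // r" by (auto intro: quotientI)
    show "finite (V // r)"
      using assms(1) eq by (intro finite_quotient) (auto simp: r_def)
  qed
  ultimately show ?thesis by blast
qed

text \<open>Gallai's lemma settles, with \<open>S = {}\<close>, the case where every vertex is
  missed by some maximum matching. Otherwise a vertex covered by all maximum matchings is deleted
  and put into \<open>S\<close>.\<close>

lemma tutte_berge:
  assumes "finite V"
  shows "\<exists>A S \<C>. A \<subseteq> V \<and> matchable F A \<and> S \<subseteq> V \<and> separated F V S \<C>
    \<and> card (V - A) + card S \<le> card \<C>"
  using assms
proof (induction "card V" arbitrary: V rule: less_induct)
  case less
  let ?cards = "card ` {B. B \<subseteq> V \<and> matchable F B}"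
  define m where "m = Max ?cards"
  have fin: "finite ?cards" using less.prems by auto
  have "?cards \<noteq> {}" using matchable.empty by blast
  then have "m \<in> ?cards" unfolding m_def using fin by (rule Max_in[rotated])
  then obtain A where A: "A \<subseteq> V" "matchable F A" "card A = m" by auto
  have max: "card B \<le> m" if "B \<subseteq> V" "matchable F B" for B
    unfolding m_def using fin that by (intro Max_ge) auto
  show ?case
  proof (cases "\<forall>v\<in>V. \<exists>B\<subseteq>V. matchable F B \<and> card B = m \<and> v \<notin> B")
    case True
    then obtain \<C> where "separated F V {} \<C>" "card (V - A) \<le> card \<C>"
      using gallai_classes[OF less.prems max _ A] by blast
    then show ?thesis using A by (intro exI[of _ A] exI[of _ "{}"] exI[of _ \<C>]) auto
  next
    case False
    then obtain v where v: "v \<in> V" "\<And>B. B \<subseteq> V \<Longrightarrow> matchable F B \<Longrightarrow> card B = m \<Longrightarrow> v \<in> B"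
      by auto
    have "card (V - {v}) < card V" using v less.prems by (intro psubset_card_mono) auto
    then obtain B S \<C> where IH: "B \<subseteq> V - {v}" "matchable F B" "S \<subseteq> V - {v}"
        "separated F (V - {v}) S \<C>" "card (V - {v} - B) + card S \<le> card \<C>"
      using less.hyps[of "V - {v}"] less.prems by auto
    \<comment> \<open>A matching avoiding \<open>v\<close> falls short of the maximum, by parity by
      at least two vertices. Deleting \<open>v\<close> accounts for one, so the deficiency rises by
      at least one, which pays for \<open>v\<close> in \<open>S\<close>.\<close>
    have "card B < m" using max[of B] v(2)[of B] IH by force
    moreover have "even (card B)" "even m" using matchable_even IH A by auto
    ultimately have "card B + 2 \<le> m" by presburger
    moreover have "card (V - A) = card V - m" "card (V - {v} - B) = card V - 1 - card B"
      using A IH v less.prems by (auto simp: card_Diff_subset finite_subset)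
    moreover have "m \<le> card V" using A less.prems card_mono by blast
    moreover have "card (insert v S) = Suc (card S)"
      using IH less.prems finite_subset[of S V] by (subst card_insert_disjoint) auto
    ultimately have "card (V - A) + card (insert v S) \<le> card \<C>" using IH(5) by linarith
    moreover have "separated F V (insert v S) \<C>"
      using IH(4) unfolding separated_def by blast
    ultimately show ?thesis
      using A IH v by (intro exI[of _ A] exI[of _ "insert v S"] exI[of _ \<C>]) auto
  qed
qed

section \<open>Ears of factor-critical sets\<close>

text \<open>The empty set qualifies vacuously, so nonemptiness has to be imposed separately;
  singletons qualify through the empty matching.\<close>

definition factor_critical :: "'a set set \<Rightarrow> 'a set \<Rightarrow> bool" where
  "factor_critical F W \<longleftrightarrow> (\<forall>w\<in>W. matchable F (W - {w}))"

abbreviation path :: "'a set set \<Rightarrow> 'a list \<Rightarrow> bool" where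
  "path F ps \<equiv> distinct ps \<and> successively (\<lambda>x y. {x, y} \<in> F) ps"

text \<open>The list holds interior vertices only, so the ear has an odd number of edges. Its ends
  \<open>a\<close> and \<open>b\<close> in \<open>W\<close> may coincide.\<close>

definition ear :: "'a set set \<Rightarrow> 'a set \<Rightarrow> 'a list \<Rightarrow> bool" where
  "ear F W ps \<longleftrightarrow> path F ps \<and> even (length ps) \<and> ps \<noteq> [] \<and> set ps \<inter> W = {}
    \<and> (\<exists>a\<in>W. {a, hd ps} \<in> F) \<and> (\<exists>b\<in>W. {last ps, b} \<in> F)"

lemma matchable_path: "path F ps \<Longrightarrow> even (length ps) \<Longrightarrow> matchable F (set ps)"
proof (induction ps rule: induct_list012)
  case (3 x y ps)
  then have "matchable F (set ps)" by (cases ps) auto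
  then show ?case using 3 matchable.add_edge[of F "set ps" x y] by auto
qed (auto intro: matchable.empty)

text \<open>If \<open>w\<close> lies in \<open>W\<close>, the interior is paired off along the path.
  Otherwise \<open>w\<close> leaves one side of odd length, which is paired together with the
  adjacent end of the ear; factor-criticality covers the rest of \<open>W\<close>.\<close>

lemma factor_critical_ear:
  assumes "factor_critical F W" "ear F W ps"
  shows "factor_critical F (W \<union> set ps)"
  unfolding factor_critical_def
proof
  fix w assume w: "w \<in> W \<union> set ps"
  have ps: "path F ps" "even (length ps)" "set ps \<inter> W = {}" using assms(2) by (auto simp: ear_def)
  obtain a b where ab: "a \<in> W" "{a, hd ps} \<in> F" "b \<in> W" "{last ps, b} \<in> F"
    using assms(2) by (auto simp: ear_def)
  show "matchable F (W \<union> set ps - {w})"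
  proof (cases "w \<in> W")
    case True
    have "matchable F ((W - {w}) \<union> set ps)"
      using assms True ps matchable_path[OF ps(1,2)]
      by (intro matchable_Un) (auto simp: factor_critical_def)
    moreover have "(W - {w}) \<union> set ps = W \<union> set ps - {w}" using True ps by auto
    ultimately show ?thesis by simp
  next
    case False
    then obtain xs ys where xy: "ps = xs @ w # ys" using w by (auto dest: split_list)
    show ?thesis
    proof (cases "even (length xs)")
      case True
      then have odd: "odd (length ys)" using ps xy by auto
      then have "ys \<noteq> []" by auto
      then have "path F (ys @ [b])"
        using ps ab xy by (auto simp: successively_append_iff successively_Cons)
      then have 1: "matchable F (set (ys @ [b]))" using odd by (intro matchable_path) auto
      have 2: "matchable F (set xs)"
        using ps True xy by (intro matchable_path) (auto simp: successively_append_iff)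
      have 3: "matchable F (W - {b})" using assms ab by (simp add: factor_critical_def)
      have "matchable F ((W - {b}) \<union> (set xs \<union> set (ys @ [b])))"
        using 1 2 3 ps xy ab by (intro matchable_Un) auto
      moreover have "(W - {b}) \<union> (set xs \<union> set (ys @ [b])) = W \<union> set ps - {w}"
        using ps xy ab False by auto
      ultimately show ?thesis by simp
    next
      case odd: False
      then have "xs \<noteq> []" by auto
      then have "path F (a # xs)"
        using ps ab xy by (auto simp: successively_append_iff successively_Cons)
      then have 1: "matchable F (set (a # xs))" using odd by (intro matchable_path) auto
      have 2: "matchable F (set ys)"
        using ps odd xy by (intro matchable_path) (auto simp: successively_append_iff successively_Cons)
      have 3: "matchable F (W - {a})" using assms ab by (simp add: factor_critical_def)
      have "matchable F ((W - {a}) \<union> (set (a # xs) \<union> set ys))"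
        using 1 2 3 ps xy ab by (intro matchable_Un) auto
      moreover have "(W - {a}) \<union> (set (a # xs) \<union> set ys) = W \<union> set ps - {w}"
        using ps xy ab False by auto
      ultimately show ?thesis by simp
    qed
  qed
qed

text \<open>Follow edges of the two perfect matchings alternately from \<open>p\<close>. The second
  misses no vertex of \<open>R\<close> but \<open>p\<close>, so the walk cannot stop before reaching
  \<open>W\<close>. It uses up whole edges of the first matching, so the rest of \<open>R\<close>
  stays matchable.\<close>

lemma alternating_path:
  assumes "matchable F R" "matchable F (W \<union> R - {p})" "p \<in> R" "W \<inter> R = {}"
  shows "\<exists>ps. path F ps \<and> even (length ps) \<and> ps \<noteq> [] \<and> hd ps = p \<and> set ps \<subseteq> R
    \<and> matchable F (R - set ps) \<and> (\<exists>b\<in>W. {last ps, b} \<in> F)"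
  using assms
proof (induction "card R" arbitrary: R p rule: less_induct)
  case less
  obtain p' where p': "p' \<in> R" "p' \<noteq> p" "{p, p'} \<in> F" "matchable F (R - {p, p'})"
    by (rule matchable_partner[OF less.prems(1,3)])
  then have "p' \<in> W \<union> R - {p}" by auto
  then obtain q where q: "q \<in> W \<union> R - {p}" "q \<noteq> p'" "{p', q} \<in> F"
      "matchable F (W \<union> R - {p} - {p', q})"
    using matchable_partner[OF less.prems(2)] by blast
  show ?case
  proof (cases "q \<in> W")
    case True
    then show ?thesis using p' q less.prems by (intro exI[of _ "[p, p']"]) auto
  next
    case False
    have "card (R - {p, p'}) < card R"
      using less.prems matchable_finite[OF less.prems(1)] by (intro psubset_card_mono) auto
    moreover have "W \<union> (R - {p, p'}) - {q} = W \<union> R - {p} - {p', q}"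
      using less.prems p' by auto
    ultimately obtain ps where ps: "path F ps" "even (length ps)" "ps \<noteq> []" "hd ps = q"
        "set ps \<subseteq> R - {p, p'}" "matchable F (R - {p, p'} - set ps)" "\<exists>b\<in>W. {last ps, b} \<in> F"
      using less.hyps[of "R - {p, p'}" q] p' q False less.prems by auto
    have "R - set (p # p' # ps) = R - {p, p'} - set ps" by auto
    with ps p' q less.prems show ?thesis
      by (intro exI[of _ "p # p' # ps"]) (auto simp: successively_Cons)
  qed
qed

text \<open>Among nonempty proper factor-critical subsets with matchable complement, take a maximal
  one. An alternating path through the complement is an ear whose addition keeps both properties, so
  it must exhaust \<open>V\<close>.\<close>

lemma last_ear_exists:
  assumes "finite V" "factor_critical F V" "card V > 1"
    and conn: "\<And>W. W \<subset> V \<Longrightarrow> W \<noteq> {} \<Longrightarrow> \<exists>a\<in>W. \<exists>p\<in>V - W. {a, p} \<in> F"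
  obtains W ps where "factor_critical F W" "ear F W ps" "W \<union> set ps = V"
proof -
  define \<W> where "\<W> = {W. W \<subset> V \<and> W \<noteq> {} \<and> factor_critical F W \<and> matchable F (V - W)}"
  obtain v where v: "v \<in> V" using assms(3) by fastforce
  then have "{v} \<noteq> V" using assms(3) by auto
  then have "{v} \<in> \<W>"
    using v assms(2) by (auto simp: \<W>_def factor_critical_def intro: matchable.empty)
  then have "\<W> \<noteq> {}" by blast
  have "\<W> \<subseteq> Pow V" by (auto simp: \<W>_def)
  then have "finite \<W>" using assms(1) by (simp add: finite_subset)
  then have "\<exists>W\<in>\<W>. \<forall>U\<in>\<W>. W \<subseteq> U \<longrightarrow> W = U"
    using \<open>\<W> \<noteq> {}\<close> by (rule finite_has_maximal)
  then obtain W where "W \<in> \<W>" and max: "\<And>U. U \<in> \<W> \<Longrightarrow> W \<subseteq> U \<Longrightarrow> W = U" by blast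
  then have W: "W \<subset> V" "W \<noteq> {}" "factor_critical F W" "matchable F (V - W)"
    by (auto simp: \<W>_def)
  obtain a p where ap: "a \<in> W" "p \<in> V - W" "{a, p} \<in> F" using conn[OF W(1,2)] by blast
  have "W \<union> (V - W) = V" using W by auto
  then have "matchable F (W \<union> (V - W) - {p})"
    using assms(2) ap by (auto simp: factor_critical_def)
  then obtain ps where ps: "path F ps" "even (length ps)" "ps \<noteq> []" "hd ps = p"
      "set ps \<subseteq> V - W" "matchable F (V - W - set ps)" "\<exists>b\<in>W. {last ps, b} \<in> F"
    using alternating_path[of F "V - W" W p] W ap by auto
  then have ear: "ear F W ps" using ap by (auto simp: ear_def)
  then have fc: "factor_critical F (W \<union> set ps)" using factor_critical_ear W by blast
  have "V - (W \<union> set ps) = V - W - set ps" by auto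
  then have "W \<union> set ps \<in> \<W>" if "W \<union> set ps \<noteq> V"
    using that W ps fc by (auto simp: \<W>_def)
  moreover have "W \<union> set ps \<noteq> W" using ps by (cases ps) auto
  ultimately have "W \<union> set ps = V" using max by blast
  then show thesis using that W ear by blast
qed

text \<open>Shrinking the last ear: if the triangle on its first edge does not leave a matchable set,
  a chord of the ear splits it into two ears, the last of which is shorter.\<close>

lemma ear_triangle:
  assumes "factor_critical F W" "ear F W ps" "W \<union> set ps = V"
    and tri: "\<And>x y. {x, y} \<in> F \<Longrightarrow> x \<noteq> y \<Longrightarrow> \<exists>z\<in>V. z \<noteq> x \<and> z \<noteq> y \<and> {x, y, z} \<in> F"
    and hered: "\<And>X Y. X \<in> F \<Longrightarrow> Y \<subseteq> X \<Longrightarrow> Y \<in> F"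
  shows "\<exists>T\<in>F. T \<subseteq> V \<and> card T = 3 \<and> matchable F (V - T)"
  using assms(1-3)
proof (induction "length ps" arbitrary: W ps rule: less_induct)
  case less
  have ps: "path F ps" "even (length ps)" "ps \<noteq> []" "set ps \<inter> W = {}"
    using less.prems(2) by (auto simp: ear_def)
  obtain a b where ab: "a \<in> W" "{a, hd ps} \<in> F" "b \<in> W" "{last ps, b} \<in> F"
    using less.prems(2) by (auto simp: ear_def)
  obtain x y rs where xy: "ps = x # y # rs"
    using ps(2,3) by (cases ps rule: remdups_adj.cases) auto
  have "{x, y} \<in> F" "x \<noteq> y" using ps xy by auto
  then obtain z where z: "z \<in> V" "z \<noteq> x" "z \<noteq> y" "{x, y, z} \<in> F" using tri by blast
  have T: "card {x, y, z} = 3" "{x, y, z} \<subseteq> V" using z \<open>x \<noteq> y\<close> xy less.prems(3) by auto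
  have rs: "path F rs" "even (length rs)" using ps xy by (auto simp: successively_Cons)
  consider "z \<in> W" | "z \<in> set rs" using z xy less.prems(3) by auto
  then show ?case
  proof cases
    case 1
    \<comment> \<open>\<open>W\<close> absorbs the loss of \<open>z\<close>, and the rest of the ear
      is paired along the path.\<close>
    have "matchable F ((W - {z}) \<union> set rs)"
      using matchable_path[OF rs] less.prems(1) 1 ps xy
      by (intro matchable_Un) (auto simp: factor_critical_def)
    moreover have "(W - {z}) \<union> set rs = V - {x, y, z}"
      using less.prems(3) ps xy 1 by auto
    ultimately have "matchable F (V - {x, y, z})" by simp
    then show ?thesis using T z(4) by blast
  next
    case 2
    then obtain us vs where rs_eq: "rs = us @ z # vs" by (auto dest: split_list)
    show ?thesis
    proof (cases "even (length us)")
      case True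
      \<comment> \<open>\<open>us\<close> is paired along the path, while \<open>vs\<close>, of odd
        length, borrows the end \<open>b\<close> from \<open>W\<close>.\<close>
      then have odd: "odd (length vs)" using rs(2) rs_eq by simp
      then have "vs \<noteq> []" by auto
      then have "path F (vs @ [b])"
        using ps ab xy rs_eq by (auto simp: successively_append_iff successively_Cons)
      then have 1: "matchable F (set (vs @ [b]))" using odd by (intro matchable_path) auto
      have 2: "matchable F (set us)"
        using rs True rs_eq by (intro matchable_path) (auto simp: successively_append_iff)
      have 3: "matchable F (W - {b})" using less.prems ab by (simp add: factor_critical_def)
      have "matchable F ((W - {b}) \<union> (set us \<union> set (vs @ [b])))"
        using 1 2 3 ps xy rs_eq ab by (intro matchable_Un) auto
      moreover have "(W - {b}) \<union> (set us \<union> set (vs @ [b])) = V - {x, y, z}"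
        using ps xy rs_eq ab less.prems(3) by auto
      ultimately have "matchable F (V - {x, y, z})" by simp
      then show ?thesis using T z(4) by blast
    next
      case odd: False
      then have "us \<noteq> []" by auto
      \<comment> \<open>The chord \<open>{x, z}\<close> bypasses \<open>y\<close> and
        \<open>us\<close>, which become the interior of a new last ear from \<open>x\<close> to
        \<open>z\<close>. As \<open>us\<close> has odd length, both new interiors are even.\<close>
      have "{x, z} \<in> F" using hered[OF z(4), of "{x, z}"] by auto
      then have "ear F W (x # z # vs)"
        unfolding ear_def using ps xy rs_eq ab odd rs
        by (auto simp: successively_append_iff successively_Cons)
      then have fc: "factor_critical F (W \<union> set (x # z # vs))"
        using factor_critical_ear less.prems(1) by blast
      have "{last us, z} \<in> F"
        using ps xy rs_eq \<open>us \<noteq> []\<close> by (auto simp: successively_append_iff successively_Cons)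
      then have "ear F (W \<union> set (x # z # vs)) (y # us)"
        unfolding ear_def using ps xy rs_eq odd \<open>us \<noteq> []\<close>
        by (auto simp: successively_append_iff successively_Cons)
      moreover have "W \<union> set (x # z # vs) \<union> set (y # us) = V"
        using less.prems(3) xy rs_eq by auto
      moreover have "length (y # us) < length ps" using xy rs_eq by simp
      ultimately show ?thesis using less.hyps[OF _ fc] by blast
    qed
  qed
qed

section \<open>Uniform regular hypergraphs\<close>

lemma hypergraph_double_count:
  assumes "regular k V E" "finite X" "X \<subseteq> V"
  shows "(\<Sum>e\<in>#E. card (e \<inter> X)) = k * card X"
proof -
  \<comment> \<open>Removing a hyperedge destroys regularity, so the exchange of summation is proved
    by induction for an arbitrary multiset.\<close>
  have "(\<Sum>e\<in>#M. card (e \<inter> X)) = (\<Sum>v\<in>X. size {#e \<in># M. v \<in> e#})" for M :: "'a set multiset"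
  proof (induction M)
    case (add e M)
    have "card (e \<inter> X) = (\<Sum>v\<in>X. if v \<in> e then 1 else 0)"
      using assms(2) by (simp add: sum.If_cases Int_commute)
    then show ?case
      using add by (auto simp: sum.distrib[symmetric] intro!: sum.cong)
  qed simp
  also have "(\<Sum>v\<in>X. size {#e \<in># E. v \<in> e#}) = (\<Sum>v\<in>X. k)"
    using assms by (intro sum.cong) (auto simp: regular_def)
  finally show ?thesis by simp
qed

text \<open>A chain of hyperedges from a vertex of \<open>W\<close> to one outside must leave
  \<open>W\<close> at some step.\<close>

lemma hconnected_crossing:
  assumes "hconnected V E" "hypergraph V E" "W \<subset> V" "W \<noteq> {}"
  obtains e x y where "e \<in># E" "x \<in> e" "y \<in> e" "x \<in> W" "y \<in> V - W"
proof -
  let ?R = "{(x, y). \<exists>e\<in>#E. x \<in> e \<and> y \<in> e}"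
  obtain u v where uv: "u \<in> W" "v \<in> V - W" using assms by auto
  then have "(u, v) \<in> ?R\<^sup>*" using assms by (auto simp: hconnected_def)
  then have "v \<in> V - W \<longrightarrow> (\<exists>x y. (x, y) \<in> ?R \<and> x \<in> W \<and> y \<in> V - W)"
  proof (induction rule: rtrancl_induct)
    case base
    then show ?case using uv by auto
  next
    case (step y z)
    have "y \<in> V" using step(2) assms(2) by (auto simp: hypergraph_def)
    then show ?case using step by blast
  qed
  then show thesis using uv that by auto
qed

text \<open>Incidences with \<open>S\<close> are counted twice: each member of \<open>\<C>\<close>
  claims at least \<open>k\<close>, each hyperedge serves at most one member, and \<open>S\<close>
  has only \<open>k * card S\<close>.\<close>

lemma separated_card_le:
  assumes "hypergraph V E" "hconnected V E" "uniform k E" "regular k V E" "k > 0"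
    and sep: "separated (hereditary_closure E) V S \<C>" and S: "S \<subseteq> V" "S \<noteq> {}"
  shows "card \<C> \<le> card S"
proof -
  let ?f = "\<lambda>C e. if e \<inter> C \<noteq> {} then card (e \<inter> S) else 0"
  have fin: "finite V" "\<And>e. e \<in># E \<Longrightarrow> finite e" "finite S"
    using assms finite_subset by (auto simp: hypergraph_def)
  have "\<C> \<subseteq> Pow V" using sep by (auto simp: separated_def)
  then have finC: "finite \<C>" using fin finite_subset by blast
  have meet: "e \<subseteq> C \<union> S" if e: "C \<in> \<C>" "e \<in># E" "e \<inter> C \<noteq> {}" for C e
  proof
    fix y assume "y \<in> e"
    obtain x where "x \<in> e" "x \<in> C" using e by auto
    moreover have "{x, y} \<in> hereditary_closure E" "y \<in> V"
      using \<open>y \<in> e\<close> \<open>x \<in> e\<close> e assms(1) by (auto simp: hereditary_closure_def hypergraph_def)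
    ultimately show "y \<in> C \<union> S" using sep e \<open>x \<in> C\<close> by (auto simp: separated_def)
  qed
  have lower: "k \<le> (\<Sum>e\<in>#E. ?f C e)" if C: "C \<in> \<C>" for C
  proof -
    have CV: "C \<subseteq> V - S" "C \<noteq> {}" using sep C by (auto simp: separated_def)
    then have "C \<subseteq> V" by auto
    then have "finite C" using fin(1) by (rule finite_subset)
    \<comment> \<open>A hyperedge meeting \<open>C\<close> has its \<open>k\<close> vertices split
      between \<open>C\<close> and \<open>S\<close>. The additive form avoids truncated
      subtraction.\<close>
    have "?f C e + card (e \<inter> C) = (if e \<inter> C \<noteq> {} then k else 0)" if "e \<in># E" for e
    proof (cases "e \<inter> C = {}")
      case False
      then have "e = (e \<inter> S) \<union> (e \<inter> C)" using meet[OF C that] by auto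
      moreover have "card ((e \<inter> S) \<union> (e \<inter> C)) = card (e \<inter> S) + card (e \<inter> C)"
        using fin(2)[OF that] CV by (intro card_Un_disjoint) auto
      ultimately show ?thesis using False assms(3) that by (auto simp: uniform_def)
    qed simp
    then have "(\<Sum>e\<in>#E. ?f C e + card (e \<inter> C)) = (\<Sum>e\<in>#E. if e \<inter> C \<noteq> {} then k else 0)"
      by (intro arg_cong[where f = sum_mset] image_mset_cong)
    also have "\<dots> = k * size {#e \<in># E. e \<inter> C \<noteq> {}#}"
      by (induction E) auto
    finally have "(\<Sum>e\<in>#E. ?f C e) + k * card C = k * size {#e \<in># E. e \<inter> C \<noteq> {}#}"
      using hypergraph_double_count[OF assms(4) \<open>finite C\<close> \<open>C \<subseteq> V\<close>] by (simp add: sum_mset.distrib)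
    then have "k dvd (\<Sum>e\<in>#E. ?f C e) + k * card C" by (simp only: dvd_triv_left)
    then have "k dvd (\<Sum>e\<in>#E. ?f C e)" by (simp only: dvd_add_left_iff[OF dvd_triv_left])
    \<comment> \<open>By connectivity some hyperedge leaves \<open>C\<close>, and it can do so only
      into \<open>S\<close>.\<close>
    moreover have "(\<Sum>e\<in>#E. ?f C e) \<noteq> 0"
    proof -
      obtain e x y where e: "e \<in># E" "x \<in> e" "y \<in> e" "x \<in> C" "y \<in> V - C"
        using hconnected_crossing[OF assms(2,1), of C] CV S by blast
      then have "y \<in> S" using meet[OF C, of e] by auto
      then have ne: "card (e \<inter> S) \<noteq> 0" "e \<inter> C \<noteq> {}" using e fin by auto
      obtain M where "E = add_mset e M" using multi_member_split[OF e(1)] by blast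
      then have "(\<Sum>e\<in>#E. ?f C e) = card (e \<inter> S) + (\<Sum>e\<in>#M. ?f C e)"
        by (simp only: image_mset_add_mset sum_mset.add_mset if_P[OF ne(2)])
      then show ?thesis using ne(1) by linarith
    qed
    ultimately show ?thesis by (intro dvd_imp_le) (simp_all only: neq0_conv)
  qed
  have upper: "(\<Sum>C\<in>\<C>. ?f C e) \<le> card (e \<inter> S)" if e: "e \<in># E" for e
  proof (cases "\<exists>C\<in>\<C>. e \<inter> C \<noteq> {}")
    case True
    then obtain C where C: "C \<in> \<C>" "e \<inter> C \<noteq> {}" by auto
    \<comment> \<open>Being contained in \<open>C \<union> S\<close>, the hyperedge misses every
      other member.\<close>
    have "?f D e = 0" if "D \<in> \<C> - {C}" for D
    proof -
      have "D \<inter> C = {}" "D \<inter> S = {}"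
        using sep C that by (auto simp: separated_def disjoint_def)
      then show ?thesis using meet[OF C(1) e C(2)] by auto
    qed
    then have "(\<Sum>D\<in>\<C> - {C}. ?f D e) = 0" by (intro sum.neutral ballI)
    then have "(\<Sum>D\<in>\<C>. ?f D e) = ?f C e" by (simp only: sum.remove[OF finC C(1)] add_0_right)
    then show ?thesis by simp
  next
    case False
    then have "(\<Sum>D\<in>\<C>. ?f D e) = 0" by (intro sum.neutral) auto
    then show ?thesis by simp
  qed
  have "k * card \<C> = (\<Sum>C\<in>\<C>. k)" by simp
  also have "\<dots> \<le> (\<Sum>C\<in>\<C>. \<Sum>e\<in>#E. ?f C e)" using lower by (rule sum_mono)
  also have "\<dots> = (\<Sum>e\<in>#E. \<Sum>C\<in>\<C>. ?f C e)"
    by (induction E) (auto simp: sum.distrib)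
  also have "\<dots> \<le> (\<Sum>e\<in>#E. card (e \<inter> S))"
    using upper by (rule sum_mset_mono)
  also have "\<dots> = k * card S"
    using hypergraph_double_count[OF assms(4) fin(3) S(1)] .
  finally show ?thesis using assms(5) by simp
qed

section \<open>Near-perfect matchings and factor-criticality\<close>

text \<open>For nonempty \<open>S\<close> the incidence bound leaves no deficiency; for
  \<open>S = {}\<close> connectivity forces \<open>\<C> \<subseteq> {V}\<close>, which allows a
  deficiency of one.\<close>

lemma deficiency_le_one:
  assumes "hypergraph V E" "hconnected V E" "uniform k E" "regular k V E" "k > 0"
  shows "\<exists>A\<subseteq>V. matchable (hereditary_closure E) A \<and> card (V - A) \<le> 1"
proof -
  let ?F = "hereditary_closure E"
  have "finite V" using assms by (simp add: hypergraph_def)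
  from tutte_berge[OF this, of ?F] obtain A S \<C> where A: "A \<subseteq> V" "matchable ?F A" "S \<subseteq> V"
      "separated ?F V S \<C>" "card (V - A) + card S \<le> card \<C>" by auto
  have "card \<C> \<le> card S + 1"
  proof (cases "S = {}")
    case True
    have "C = V" if "C \<in> \<C>" for C
    proof (rule ccontr)
      assume "C \<noteq> V"
      moreover have C: "C \<subseteq> V" "C \<noteq> {}" "\<forall>x\<in>C. \<forall>y\<in>V. {x, y} \<in> ?F \<longrightarrow> y \<in> C"
        using A(4) that True by (auto simp: separated_def)
      ultimately obtain e x y where "e \<in># E" "x \<in> e" "y \<in> e" "x \<in> C" "y \<in> V - C"
        using hconnected_crossing[OF assms(2,1), of C] by blast
      then show False using C by (auto simp: hereditary_closure_def)
    qed
    then have "\<C> \<subseteq> {V}" by auto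
    then show ?thesis using card_mono[of "{V}" \<C>] by simp
  next
    case False
    then show ?thesis using separated_card_le[OF assms A(4,3)] by simp
  qed
  then show ?thesis using A by auto
qed

text \<open>The Tutte--Berge bound is applied to \<open>V - {v}\<close>. Moving \<open>v\<close>
  into \<open>S\<close> makes the incidence bound available and limits the deficiency to one; parity
  then makes it zero.\<close>

lemma odd_factor_critical:
  assumes "hypergraph V E" "hconnected V E" "uniform k E" "regular k V E" "k > 0" "odd (card V)"
  shows "factor_critical (hereditary_closure E) V"
  unfolding factor_critical_def
proof
  let ?F = "hereditary_closure E"
  fix v assume v: "v \<in> V"
  have fin: "finite V" using assms by (simp add: hypergraph_def)
  then have "finite (V - {v})" by simp
  from tutte_berge[OF this, of ?F] obtain A S \<C> where A: "A \<subseteq> V - {v}" "matchable ?F A"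
      "S \<subseteq> V - {v}" "separated ?F (V - {v}) S \<C>" "card (V - {v} - A) + card S \<le> card \<C>" by auto
  have "separated ?F V (insert v S) \<C>" using A(4) unfolding separated_def by blast
  then have "card \<C> \<le> card (insert v S)" using separated_card_le[OF assms(1-5)] A(3) v by auto
  also have "\<dots> \<le> card S + 1" by (simp add: card_insert_le_m1 card_insert_if)
  finally have le: "card (V - {v} - A) \<le> 1" using A(5) by simp
  have "finite A" using matchable_finite A by auto
  then have "card (V - {v} - A) + card A + 1 = card V"
    using A(1) v fin card_mono[of "V - {v}" A] card_gt_0_iff[of V]
    by (auto simp: card_Diff_subset)
  then have "even (card (V - {v} - A))"
    using matchable_even[OF A(2)] assms(6) by presburger
  then have "card (V - {v} - A) = 0" using le by presburger
  then have "V - {v} = A" using A(1) fin by auto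
  then show "matchable ?F (V - {v})" using A by simp
qed

section \<open>The partition, by parity of \<open>card V\<close>\<close>

theorem corollary3p2:
  fixes V :: "'a set" and E :: "'a set multiset" and k :: nat
  assumes "hypergraph V E"
    and "hconnected V E"
    and "uniform k E"
    and "regular k V E"
    and "k \<ge> 3"
  shows "\<exists>P. partition_on V P \<and> P \<subseteq> hereditary_closure E
    \<and> (\<forall>X\<in>P. card X = 2 \<or> card X = 3)
    \<and> card {X \<in> P. card X = 3} \<le> 1"
proof (cases "even (card V)")
  case True
  let ?F = "hereditary_closure E"
  obtain A where A: "A \<subseteq> V" "matchable ?F A" "card (V - A) \<le> 1"
    using deficiency_le_one[OF assms(1-4)] assms(5) by auto
  have fin: "finite V" using assms by (simp add: hypergraph_def)
  then have "card (V - A) + card A = card V"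
    using A card_mono[of V A] by (simp add: card_Diff_subset finite_subset)
  then have "even (card (V - A))" using True matchable_even[OF A(2)] by presburger
  then have "card (V - A) = 0" using A(3) by presburger
  then have "V = A" using A(1) fin by auto
  then obtain P where P: "partition_on V P" "P \<subseteq> ?F" "\<forall>X\<in>P. card X = 2"
    using matchable_partition[OF A(2)] by blast
  then have "{X \<in> P. card X = 3} = {}" by auto
  then have "card {X \<in> P. card X = 3} \<le> 1" by (simp only: card.empty)
  then show ?thesis using P by blast
next
  case False
  let ?F = "hereditary_closure E"
  have fin: "finite V" using assms by (simp add: hypergraph_def)
  have hered: "Y \<in> ?F" if "X \<in> ?F" "Y \<subseteq> X" for X Y
    using that by (auto simp: hereditary_closure_def)
  have tri: "\<exists>z\<in>V. z \<noteq> x \<and> z \<noteq> y \<and> {x, y, z} \<in> ?F" if xy: "{x, y} \<in> ?F" for x y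
  proof -
    obtain e where e: "e \<in># E" "{x, y} \<subseteq> e" using xy by (auto simp: hereditary_closure_def)
    \<comment> \<open>\<open>{x, y}\<close> has at most two elements, also when
      \<open>x = y\<close>, while \<open>e\<close> has \<open>k \<ge> 3\<close>.\<close>
    have "card {x, y} < card e"
      using e assms(3,5) card_insert_le_m1[of 2 "{y}" x] by (auto simp: uniform_def)
    then obtain z where "z \<in> e" "z \<notin> {x, y}"
      by (metis card_mono finite.emptyI finite_insert not_less subsetI)
    then show ?thesis using e assms(1) by (auto simp: hereditary_closure_def hypergraph_def)
  qed
  have conn: "\<exists>a\<in>W. \<exists>p\<in>V - W. {a, p} \<in> ?F" if W: "W \<subset> V" "W \<noteq> {}" for W
  proof -
    obtain e x y where "e \<in># E" "x \<in> e" "y \<in> e" "x \<in> W" "y \<in> V - W"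
      using hconnected_crossing[OF assms(2,1) W] by blast
    then show ?thesis by (auto simp: hereditary_closure_def)
  qed
  \<comment> \<open>A last ear requires more than one vertex. An odd \<open>V\<close> has a vertex,
    which lies in a hyperedge with \<open>k \<ge> 3\<close> vertices.\<close>
  have "card V > 1"
  proof -
    obtain v where "v \<in> V" using False by fastforce
    then have "size {#e \<in># E. v \<in> e#} = k" using assms(4) by (simp add: regular_def)
    then have "{#e \<in># E. v \<in> e#} \<noteq> {#}" using assms(5) by (metis not_numeral_le_zero size_empty)
    then obtain e where "e \<in># E" using multiset_nonemptyE by fastforce
    then have "e \<subseteq> V" "card e = k" using assms(1,3) by (auto simp: hypergraph_def uniform_def)
    then have "k \<le> card V" using card_mono[OF fin] by blast
    then show ?thesis using assms(5) by simp
  qed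
  moreover have "factor_critical ?F V" using odd_factor_critical[OF assms(1-4)] assms(5) False by simp
  ultimately obtain W ps where "factor_critical ?F W" "ear ?F W ps" "W \<union> set ps = V"
    using last_ear_exists[OF fin _ _ conn] by blast
  then obtain T where T: "T \<in> ?F" "T \<subseteq> V" "card T = 3" "matchable ?F (V - T)"
    using ear_triangle[of ?F W ps V] tri hered by blast
  obtain P where P: "partition_on (V - T) P" "P \<subseteq> ?F" "\<forall>X\<in>P. card X = 2"
    by (rule matchable_partition[OF T(4)])
  have "T \<noteq> {}" using T(3) by auto
  then have "partition_on V (insert T P)"
    using partition_on_add_part[OF P(1), of T] T(2) by (simp add: Un_absorb1)
  moreover have "{X \<in> insert T P. card X = 3} = {T}" using P T by auto
  ultimately show ?thesis using P T by (intro exI[of _ "insert T P"]) auto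
qed

end
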